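(* As formal power series in $q$ with coefficients polynomials in $z$: $$\sum_{\lambda\in\mathcal{P}_1'}z^{a(\lambda)}q^{|\lambda|}=\sum_{n=0}^{\infty}\frac{q^{4n}(-zq^{-3};q^4)_{n}}{(q^4;q^4)_{n}(z^2q^2;q^4)_{n}}+\sum_{n=0}^{\infty}\frac{z^2q^{4n+2}(-zq;q^4)_{n}}{(q^4;q^4)_{n}(z^2q^2;q^4)_{n+1}}=\frac{(-zq;q^4)_{\infty}}{(z^2q^2;q^4)_{\infty}(q^4;q^4)_{\infty}},$$ $$\sum_{\lambda\in\mathcal{P}_2'}z^{a(\lambda)}q^{|\lambda|}=\sum_{n=0}^{\infty}\frac{q^{4n}(-z/q;q^4)_{n}}{(q^4;q^4)_{n}(z^2q^2;q^4)_{n}}+\sum_{n=0}^{\infty}\frac{z^2q^{4n+2}(-zq^3;q^4)_{n}}{(q^4;q^4)_{n}(z^2q^2;q^4)_{n+1}}=\frac{(-zq^3;q^4)_{\infty}}{(z^2q^2;q^4)_{\infty}(q^4;q^4)_{\infty}},$$ $$\sum_{\lambda\in\mathcal{P}_1'}z^{a(\lambda)}q^{S(\lambda)}=\sum_{n=0}^{\infty}\frac{q^{2n}(-zq^{-1};q^2)_{n}}{(q^2;q^2)_{n}(z^2q^2;q^2)_{n}}+\sum_{n=0}^{\infty}\frac{z^2q^{2n+2}(-zq;q^2)_{n}}{(q^2;q^2)_{n}(z^2q^2;q^2)_{n+1}}=\frac{(-zq;q^2)_{\infty}}{(z^2q^2;q^2)_{\infty}(q^2;q^2)_{\infty}},$$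 $$\sum_{\lambda\in\mathcal{P}_2'}z^{a(\lambda)}q^{S(\lambda)}=1+\sum_{n=1}^{\infty}\frac{q^{2n}(-z;q^2)_{n}}{(q^2;q^2)_{n}(z^2q^2;q^2)_{n}}+\sum_{n=0}^{\infty}\frac{z^2q^{2n+2}(-zq^2;q^2)_{n}}{(q^2;q^2)_{n}(z^2q^2;q^2)_{n+1}}=\frac{(-zq^2;q^2)_{\infty}}{(z^2q^2;q^2)_{\infty}(q^2;q^2)_{\infty}}.$$
   Context: A partition is a finite weakly decreasing sequence of positive integers $\lambda=(\lambda_1,\ldots,\lambda_\ell)$ (the empty partition is included), of weight $|\lambda|=\lambda_1+\cdots+\lambda_\ell$. The odd-indexed parts are $\lambda_1,\lambda_3,\ldots$ and the even-indexed parts are $\lambda_2,\lambda_4,\ldots$. The alternating sum is $a(\lambda)=\lambda_1-\lambda_2+\lambda_3-\cdots+(-1)^{\ell-1}\lambda_\ell$ and the Schmidt weight is $S(\lambda)=\lambda_1+\lambda_3+\lambda_5+\cdots$. $\mathcal{P}_1'$ is the set of partitions whose even-indexed parts are all even; $\mathcal{P}_2'$ is the set of partitions whose odd-indexed parts are all even. Both contain the empty partition. Notation: $(a;q)_0=1$, $(a;q)_n=\prod_{i=0}^{n-1}(1-aq^i)$, $(a;q)_\infty=\lim_{n\to\infty}(a;q)_n$. Negative powers of $q$ cancel against the monomial prefactors. *)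

theory Defs
  imports "HOL-Analysis.Analysis" "HOL-Computational_Algebra.Formal_Laurent_Series"
begin

definition partitions :: "nat list set" where
  "partitions = {xs. sorted_wrt (\<ge>) xs \<and> (\<forall>x\<in>set xs. 0 < x)}"

text \<open>Lists are indexed from 0, so the odd-indexed parts of a partition, counted from 1,
  are the entries at even positions.\<close>

definition P1' :: "nat list set" where
  "P1' = {xs \<in> partitions. \<forall>i<length xs. odd i \<longrightarrow> even (xs ! i)}"

definition P2' :: "nat list set" where
  "P2' = {xs \<in> partitions. \<forall>i<length xs. even i \<longrightarrow> even (xs ! i)}"

definition alt_sum :: "nat list \<Rightarrow> int" where
  "alt_sum xs = (\<Sum>i<length xs. (- 1) ^ i * int (xs ! i))"

definition schmidt_weight :: "nat list \<Rightarrow> nat" where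
  "schmidt_weight xs = (\<Sum>i | i < length xs \<and> even i. xs ! i)"

definition qpoch :: "'a::comm_ring_1 \<Rightarrow> 'a \<Rightarrow> nat \<Rightarrow> 'a" where
  "qpoch a q n = (\<Prod>i<n. 1 - a * q ^ i)"

definition qpoch_inf :: "'a::{comm_ring_1,t2_space} \<Rightarrow> 'a \<Rightarrow> 'a" where
  "qpoch_inf a q = lim (\<lambda>n. qpoch a q n)"

text \<open>The ambient ring is that of formal Laurent series in \<open>q\<close> over the polynomials in \<open>z\<close>,
  with the library's \<open>q\<close>-adic topology; it contains the formal power series and
  gives a meaning to the individual negative powers of \<open>q\<close>.\<close>

abbreviation qv :: "int poly fls" where
  "qv \<equiv> fls_X"

abbreviation qv_inv :: "int poly fls" where
  "qv_inv \<equiv> fls_X_inv"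

abbreviation zv :: "int poly fls" where
  "zv \<equiv> fls_const [:0, 1:]"

text \<open>Polynomials have no \<open>inverse\<close> operation, so \<open>/\<close> is not available on this ring. The
  following is the quotient \<open>f / g\<close> whenever the lowest coefficient of \<open>g\<close> is 1.\<close>

definition fls_quot :: "'a::comm_ring_1 fls \<Rightarrow> 'a fls \<Rightarrow> 'a fls" (infixl "\<oslash>" 70) where
  "f \<oslash> g = f * fls_right_inverse g 1"

lemma fls_quot_mult:
  assumes "fls_nth g (fls_subdegree g) = 1"
  shows "(f \<oslash> g) * g = f"
proof -
  have "g * fls_right_inverse g 1 = 1"
    by (rule fls_right_inverse) (simp add: assms)
  then show ?thesis
    unfolding fls_quot_def by (metis mult.assoc mult.commute mult_1_right)
qed

lemma alt_sum_Cons: "alt_sum (x # xs) = int x - alt_sum xs"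
  unfolding alt_sum_def
  by (simp add: sum.lessThan_Suc_shift sum_negf del: sum.lessThan_Suc)

text \<open>Hence the exponent \<open>nat (alt_sum xs)\<close> of \<open>z\<close> loses nothing.\<close>

lemma alt_sum_nonneg:
  assumes "xs \<in> partitions"
  shows "0 \<le> alt_sum xs"
proof -
  have "sorted_wrt (\<ge>) xs \<Longrightarrow> 0 \<le> alt_sum xs \<and> (xs \<noteq> [] \<longrightarrow> alt_sum xs \<le> int (hd xs))"
  proof (induction xs)
    case Nil
    show ?case by (simp add: alt_sum_def)
  next
    case (Cons x xs)
    then show ?case
      by (cases xs) (auto simp: alt_sum_Cons alt_sum_def[of "[]"])
  qed
  then show ?thesis using assms by (simp add: partitions_def)
qed

end

theory Submission
  imports Defs
begin

text \<open>
  Put \<open>x = z\<^sup>2q\<^sup>2\<close>, \<open>Q = q\<^sup>s\<close> with \<open>s = 4\<close> or \<open>s = 2\<close>, and \<open>w = -zq\<^sup>r\<close>. In all four cases the double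
  sum telescopes: the first \<open>N + 1\<close> terms of the first series and the first \<open>N\<close> terms of the
  second one add up to \<open>(w;Q)\<^sub>N / ((Q;Q)\<^sub>N (x;Q)\<^sub>N)\<close>.

  A partition is determined by the differences \<open>m\<^sub>i = \<lambda>\<^sub>i - \<lambda>\<^sub>i\<^sub>+\<^sub>1\<close>, and all three statistics are linear in
  them. The parity conditions say that \<open>m\<^sub>i + m\<^sub>i\<^sub>+\<^sub>1\<close> is even for every other \<open>i\<close>, so the
  generating function factors over the pairs \<open>(m\<^sub>i, m\<^sub>i\<^sub>+\<^sub>1) = (2a + e, 2b + e)\<close> with \<open>e \<in> {0, 1}\<close>
  (and, for the first class, over the unpaired \<open>m\<^sub>1 = 2a + e\<close>); the parameters account for one factor each of \<open>(x;Q)\<^sub>\<infinity>\<close>, \<open>(Q;Q)\<^sub>\<infinity>\<close>, \<open>(w;Q)\<^sub>\<infinity>\<close>.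
\<close>

unbundle no vec_syntax

section \<open>Limits of formal power series\<close>

text \<open>Both distances depend only on the subdegree of the difference, which the embedding
  preserves. Limits can thus be computed among power series and transferred afterwards.\<close>

lemma dist_fps_to_fls:
  fixes f g :: "'a::group_add fps"
  shows "dist (fps_to_fls f) (fps_to_fls g) = dist f g"
  by (simp add: dist_fls_def dist_fps_def fls_subdegree_fls_to_fps flip: fps_to_fls_minus)

lemma tendsto_fps_to_fls:
  fixes f :: "'b \<Rightarrow> 'a::group_add fps"
  assumes "(f \<longlongrightarrow> L) F"
  shows "((\<lambda>x. fps_to_fls (f x)) \<longlongrightarrow> fps_to_fls L) F"
  using assms by (simp add: tendsto_dist_iff[of _ "fps_to_fls L"] tendsto_dist_iff[of _ L] dist_fps_to_fls)

lemma fps_to_fls_sum: "fps_to_fls (sum f A) = (\<Sum>x\<in>A. fps_to_fls (f x))"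
  for f :: "'b \<Rightarrow> 'a::comm_ring_1 fps"
  by (induction A rule: infinite_finite_induct) auto

lemma sums_fps_to_fls:
  fixes f :: "nat \<Rightarrow> 'a::comm_ring_1 fps"
  assumes "f sums L"
  shows "(\<lambda>n. fps_to_fls (f n)) sums fps_to_fls L"
  using tendsto_fps_to_fls[OF assms[unfolded sums_def]] by (simp add: sums_def fps_to_fls_sum)

lemma tendsto_add_fps:
  fixes f g :: "'b \<Rightarrow> 'a::comm_ring_1 fps"
  assumes "(f \<longlongrightarrow> L) F" "(g \<longlongrightarrow> M) F"
  shows "((\<lambda>x. f x + g x) \<longlongrightarrow> L + M) F"
proof (rule tendsto_fpsI)
  fix n
  from assms have "\<forall>\<^sub>F x in F. f x $ n = L $ n" "\<forall>\<^sub>F x in F. g x $ n = M $ n"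
    by (auto simp: tendsto_fps_iff)
  then show "\<forall>\<^sub>F x in F. (f x + g x) $ n = (L + M) $ n"
    by eventually_elim simp
qed

text \<open>Convergence means that every coefficient is eventually constant, and coefficient
  \<open>n\<close> of a product involves only the finitely many coefficients up to \<open>n\<close>
  of the factors.\<close>

lemma tendsto_mult_fps:
  fixes f g :: "'b \<Rightarrow> 'a::comm_ring_1 fps"
  assumes "(f \<longlongrightarrow> L) F" "(g \<longlongrightarrow> M) F"
  shows "((\<lambda>x. f x * g x) \<longlongrightarrow> L * M) F"
proof (rule tendsto_fpsI)
  fix n
  from assms have "\<forall>\<^sub>F x in F. \<forall>i\<in>{..n}. f x $ i = L $ i" "\<forall>\<^sub>F x in F. \<forall>i\<in>{..n}. g x $ i = M $ i"
    by (auto simp: tendsto_fps_iff eventually_ball_finite_distrib)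
  then show "\<forall>\<^sub>F x in F. (f x * g x) $ n = (L * M) $ n"
    by eventually_elim (simp add: fps_mult_nth)
qed

text \<open>From index \<open>Suc j\<close> on no step changes coefficient \<open>j\<close>, so the
  limit reads it off at \<open>s (Suc j)\<close>.\<close>

lemma LIMSEQ_fpsI:
  fixes s :: "nat \<Rightarrow> 'a::comm_ring_1 fps"
  assumes "\<And>n j. j < n \<Longrightarrow> (s (Suc n) - s n) $ j = 0"
  shows "s \<longlonglongrightarrow> Abs_fps (\<lambda>j. s (Suc j) $ j)"
proof (rule tendsto_fpsI)
  fix j
  have "s n $ j = s (Suc j) $ j" if "n \<ge> Suc j" for n
    using that
  proof (induction n rule: dec_induct)
    case (step n)
    then have "s (Suc n) $ j - s n $ j = 0" using assms[of j n] by simp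
    with step.IH show ?case by simp
  qed simp
  then show "\<forall>\<^sub>F n in sequentially. s n $ j = Abs_fps (\<lambda>j. s (Suc j) $ j) $ j"
    unfolding fps_nth_Abs_fps by (rule eventually_sequentiallyI)
qed

lemma summable_fps:
  fixes t :: "nat \<Rightarrow> 'a::comm_ring_1 fps"
  assumes "\<And>n j. j < n \<Longrightarrow> t n $ j = 0"
  shows "summable t"
proof -
  have "(\<lambda>n. \<Sum>i<n. t i) \<longlonglongrightarrow> Abs_fps (\<lambda>j. (\<Sum>i<Suc j. t i) $ j)"
    by (rule LIMSEQ_fpsI) (simp add: assms)
  then show ?thesis by (auto simp: summable_def sums_def)
qed

lemma fps_power_mult_nth_less:
  fixes Q f :: "'a::comm_ring_1 fps"
  assumes "Q $ 0 = 0" "j < n"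
  shows "(Q ^ n * f) $ j = 0"
  using assms startsby_zero_power_prefix[of Q] by (simp add: fps_mult_nth)

section \<open>The telescoping identity\<close>

lemma qpoch_Suc: "qpoch a q (Suc n) = qpoch a q n * (1 - a * q ^ n)"
  by (simp add: qpoch_def)

lemma qpoch_Suc_shift: "qpoch a q (Suc n) = (1 - a) * qpoch (a * q) q n"
  unfolding qpoch_def prod.lessThan_Suc_shift by (simp add: mult.assoc)

lemma qpoch_0 [simp]: "qpoch a q 0 = 1"
  by (simp add: qpoch_def)

lemma fps_to_fls_qpoch:
  fixes a q :: "'a::comm_ring_1 fps"
  shows "fps_to_fls (qpoch a q n) = qpoch (fps_to_fls a) (fps_to_fls q) n"
  by (induction n) (simp_all add: qpoch_Suc fls_times_fps_to_fls fps_to_fls_power)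

text \<open>Consecutive products differ by a multiple of \<open>q ^ n\<close>, which has no
  coefficient below \<open>n\<close>. Hence the \<open>lim\<close> in \<open>qpoch_inf\<close> is a
  genuine limit.\<close>

lemma qpoch_tendsto:
  fixes a q :: "'a::comm_ring_1 fps"
  assumes "q $ 0 = 0"
  shows "qpoch a q \<longlonglongrightarrow> qpoch_inf a q"
proof -
  have "(qpoch a q (Suc n) - qpoch a q n) $ j = 0" if "j < n" for n j
  proof -
    have "qpoch a q (Suc n) - qpoch a q n = q ^ n * (- qpoch a q n * a)"
      by (simp add: qpoch_Suc algebra_simps)
    then show ?thesis using fps_power_mult_nth_less[OF assms that] by metis
  qed
  from LIMSEQ_fpsI[of "qpoch a q", OF this] show ?thesis
    by (simp add: qpoch_inf_def limI)
qed

lemma qpoch_inf_fps_to_fls: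
  fixes a q :: "'a::comm_ring_1 fps"
  assumes "q $ 0 = 0"
  shows "qpoch_inf (fps_to_fls a) (fps_to_fls q) = fps_to_fls (qpoch_inf a q)"
  using tendsto_fps_to_fls[OF qpoch_tendsto[OF assms, of a]]
  by (simp add: qpoch_inf_def[of "fps_to_fls a"] fps_to_fls_qpoch limI)

lemma qpoch_nth_0:
  fixes a q :: "'a::comm_ring_1 fps"
  assumes "a $ 0 = 0"
  shows "qpoch a q n $ 0 = 1"
  by (induction n) (simp_all add: qpoch_Suc assms)

lemma qpoch_inf_nth_0:
  fixes a q :: "'a::comm_ring_1 fps"
  assumes "a $ 0 = 0" "q $ 0 = 0"
  shows "qpoch_inf a q $ 0 = 1"
proof -
  have "\<forall>\<^sub>F n in sequentially. qpoch a q n $ 0 = qpoch_inf a q $ 0"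
    using qpoch_tendsto[OF assms(2)] by (simp add: tendsto_fps_iff)
  then show ?thesis by (simp add: qpoch_nth_0 assms)
qed

text \<open>The second argument of \<open>fps_right_inverse\<close> prescribes the inverse of the
  constant coefficient; with 1 there, this is the reciprocal of a series that starts with 1, over
  any commutative ring.\<close>

abbreviation fps_recip :: "'a::comm_ring_1 fps \<Rightarrow> 'a fps" where
  "fps_recip g \<equiv> fps_right_inverse g 1"

lemma fps_recip: "g * fps_recip g = 1" if "g $ 0 = 1"
  using that by (intro fps_right_inverse) simp

text \<open>Extends a fraction by \<open>g\<close>; used to bring terms over a common
  denominator.\<close>

lemma fps_recip_mult:
  fixes f g :: "'a::comm_ring_1 fps"
  assumes "f $ 0 = 1" "g $ 0 = 1"
  shows "fps_recip f = g * fps_recip (f * g)"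
proof -
  have "fps_recip f = fps_recip f * (f * g * fps_recip (f * g))"
    using assms by (simp add: fps_recip[of "f * g"])
  also have "\<dots> = (f * fps_recip f) * (g * fps_recip (f * g))"
    by (simp only: mult_ac)
  also have "\<dots> = g * fps_recip (f * g)"
    using assms by (simp add: fps_recip)
  finally show ?thesis .
qed

text \<open>A constant coefficient 1 forces subdegree 0, so the Laurent inverse is the image of the
  power series reciprocal. The numerator may still be any Laurent series.\<close>

lemma fls_quot_fps:
  fixes g :: "'a::comm_ring_1 fps"
  assumes "g $ 0 = 1"
  shows "f \<oslash> fps_to_fls g = f * fps_to_fls (fps_recip g)"
proof -
  have "subdegree g = 0" using assms by (simp add: subdegree_eq_0)
  then show ?thesis unfolding fls_quot_def by (rule arg_cong[OF fls_lr_inverse_fps_to_fls(2)])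
qed

text \<open>With the factor \<open>(w/Q;Q)\<^sub>n\<close> of the paper written as \<open>(1 - w/Q) (w;Q)\<^sub>n\<^sub>-\<^sub>1\<close>, the negative
  powers of \<open>q\<close> cancel against \<open>Q\<^sup>n\<close>.\<close>

definition termA :: "'a::comm_ring_1 fps \<Rightarrow> 'a fps \<Rightarrow> 'a fps \<Rightarrow> nat \<Rightarrow> 'a fps" where
  "termA w x Q n = (case n of 0 \<Rightarrow> 1 | Suc m \<Rightarrow>
     Q ^ m * ((Q - w) * qpoch w Q m * fps_recip (qpoch Q Q (Suc m) * qpoch x Q (Suc m))))"

text \<open>With x = z^2 q^2, the parameter \<open>x\<close> doubles as the monomial prefactor of
  the second series.\<close>

definition termB :: "'a::comm_ring_1 fps \<Rightarrow> 'a fps \<Rightarrow> 'a fps \<Rightarrow> nat \<Rightarrow> 'a fps" where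
  "termB w x Q n = Q ^ n * (x * qpoch w Q n * fps_recip (qpoch Q Q n * qpoch x Q (Suc n)))"

context
  fixes w x Q :: "'a::comm_ring_1 fps"
  assumes w0: "w $ 0 = 0" and x0: "x $ 0 = 0" and Q0: "Q $ 0 = 0"
begin

text \<open>Induction on \<open>n\<close>. Over the common denominator \<open>D'\<close>, and with t
  = Q^n, the step is the polynomial identity (1 - Qt)(1 - xt) + (Q - w)t + xt(1 - Qt) = 1 - wt. The
  leading 1 is term 0 of the first series, which is therefore always one term ahead of the
  second.\<close>

lemma telescope:
  "(1 + (\<Sum>i<n. termA w x Q (Suc i)) + (\<Sum>i<n. termB w x Q i)) * (qpoch Q Q n * qpoch x Q n) = qpoch w Q n"
proof (induction n)
  case (Suc n)
  define D where "D = qpoch Q Q n * qpoch x Q n"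
  define D' where "D' = qpoch Q Q (Suc n) * qpoch x Q (Suc n)"
  define S where "S = 1 + (\<Sum>i<n. termA w x Q (Suc i)) + (\<Sum>i<n. termB w x Q i)"
  have D'_eq: "D' = D * ((1 - Q * Q ^ n) * (1 - x * Q ^ n))"
    by (simp add: D_def D'_def qpoch_Suc mult_ac)
  have "fps_recip D' * D' = 1"
    using fps_recip[of D'] by (simp add: D'_def qpoch_nth_0 x0 Q0 mult.commute)
  then have A: "termA w x Q (Suc n) * D' = Q ^ n * ((Q - w) * qpoch w Q n)"
    by (simp add: termA_def D'_def[symmetric] mult.assoc)
  \<comment> \<open>The denominator of \<open>termB w x Q n\<close> lacks just the last factor of
    \<open>qpoch Q Q (Suc n)\<close>.\<close>
  have "qpoch Q Q n * qpoch x Q (Suc n) * (1 - Q * Q ^ n) = D'"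
    by (simp add: D'_def qpoch_Suc[of Q] mult_ac)
  then have "fps_recip (qpoch Q Q n * qpoch x Q (Suc n)) = (1 - Q * Q ^ n) * fps_recip D'"
    using fps_recip_mult[of "qpoch Q Q n * qpoch x Q (Suc n)" "1 - Q * Q ^ n"]
    by (simp add: qpoch_nth_0 x0 Q0)
  with \<open>fps_recip D' * D' = 1\<close>
  have B: "termB w x Q n * D' = Q ^ n * (x * qpoch w Q n * (1 - Q * Q ^ n))"
    by (simp add: termB_def mult.assoc)
  have "(1 + (\<Sum>i<Suc n. termA w x Q (Suc i)) + (\<Sum>i<Suc n. termB w x Q i)) * D'
        = S * D' + termA w x Q (Suc n) * D' + termB w x Q n * D'"
    by (simp add: S_def algebra_simps)
  also have "S * D' = qpoch w Q n * ((1 - Q * Q ^ n) * (1 - x * Q ^ n))"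
    using Suc.IH by (simp add: D'_eq mult.assoc[symmetric] D_def S_def)
  finally show ?case
    by (simp add: A B D'_def[symmetric] qpoch_Suc[of w]) (simp add: algebra_simps)
qed simp

lemma summable_termA: "summable (\<lambda>n. termA w x Q (Suc n))"
  by (rule summable_fps) (simp add: termA_def fps_power_mult_nth_less Q0)

lemma summable_termB: "summable (termB w x Q)"
  by (rule summable_fps) (simp add: termB_def fps_power_mult_nth_less Q0)

lemma sums_termA: "termA w x Q sums (1 + (\<Sum>n. termA w x Q (Suc n)))"
proof -
  have "(\<lambda>n. 1 + (\<Sum>i<n. termA w x Q (Suc i))) \<longlonglongrightarrow> 1 + (\<Sum>n. termA w x Q (Suc n))"
    using summable_termA[THEN summable_sums] by (intro tendsto_add_fps) (auto simp: sums_def)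
  moreover have "(\<Sum>i<Suc n. termA w x Q i) = 1 + (\<Sum>i<n. termA w x Q (Suc i))" for n
    by (simp add: sum.lessThan_Suc_shift termA_def[of _ _ _ 0] del: sum.lessThan_Suc)
  ultimately show ?thesis
    unfolding sums_def by (subst filterlim_sequentially_Suc[symmetric]) simp
qed

text \<open>Every factor and both partial sums in \<open>telescope\<close> converge, so the identity
  passes to the limit.\<close>

lemma telescope_limit:
  "(1 + (\<Sum>n. termA w x Q (Suc n)) + (\<Sum>n. termB w x Q n)) * (qpoch_inf x Q * qpoch_inf Q Q) = qpoch_inf w Q"
proof -
  have "(\<lambda>n. (1 + (\<Sum>i<n. termA w x Q (Suc i)) + (\<Sum>i<n. termB w x Q i)) * (qpoch x Q n * qpoch Q Q n))
    \<longlonglongrightarrow> (1 + (\<Sum>n. termA w x Q (Suc n)) + (\<Sum>n. termB w x Q n)) * (qpoch_inf x Q * qpoch_inf Q Q)"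
    using summable_termA[THEN summable_sums] summable_termB[THEN summable_sums]
    by (intro tendsto_mult_fps tendsto_add_fps qpoch_tendsto Q0) (auto simp: sums_def)
  then show ?thesis
    using qpoch_tendsto[OF Q0, of w] LIMSEQ_unique
    by (simp add: telescope mult.commute[of "qpoch x Q _"])
qed

end

section \<open>Transfer of the identity to Laurent series\<close>

lemma termA_fps_to_fls:
  fixes w x Q :: "'a::comm_ring_1 fps"
  assumes "w $ 0 = 0" "x $ 0 = 0" "Q $ 0 = 0"
    and w': "w' * fps_to_fls Q = fps_to_fls w"
  shows "fps_to_fls Q ^ n * qpoch w' (fps_to_fls Q) n
      \<oslash> (qpoch (fps_to_fls Q) (fps_to_fls Q) n * qpoch (fps_to_fls x) (fps_to_fls Q) n)
    = fps_to_fls (termA w x Q n)"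
proof -
  have "fps_to_fls Q ^ n * qpoch w' (fps_to_fls Q) n * fps_to_fls (fps_recip (qpoch Q Q n * qpoch x Q n))
    = fps_to_fls (termA w x Q n)"
  proof (cases n)
    case 0
    have "fps_recip (1 :: 'a fps) = 1"
      using fps_recip[of "1 :: 'a fps"] by simp
    with 0 show ?thesis by (simp add: termA_def)
  next
    case (Suc m)
    \<comment> \<open>Here \<open>w'\<close> stands for w/Q, which need not be a power series. It
      enters only through the first factor 1 - w' of its q-Pochhammer symbol; one factor of
      \<open>Q ^ n\<close> turns that into Q - w, and the remaining factors start at w' Q =
      w.\<close>
    have "fps_to_fls Q * (1 - w') = fps_to_fls (Q - w)"
      by (simp add: algebra_simps flip: w')
    moreover have "fps_to_fls Q ^ n * qpoch w' (fps_to_fls Q) n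
      = (fps_to_fls Q * (1 - w')) * (fps_to_fls Q ^ m * qpoch (w' * fps_to_fls Q) (fps_to_fls Q) m)"
      by (simp add: Suc qpoch_Suc_shift mult_ac)
    ultimately have "fps_to_fls Q ^ n * qpoch w' (fps_to_fls Q) n
      = fps_to_fls ((Q - w) * (Q ^ m * qpoch w Q m))"
      by (simp only: w' fps_to_fls_qpoch fps_to_fls_power fls_times_fps_to_fls)
    then show ?thesis
      by (simp add: Suc termA_def mult_ac flip: fls_times_fps_to_fls)
  qed
  then show ?thesis
    using assms fls_quot_fps[of "qpoch Q Q n * qpoch x Q n"]
    by (simp add: qpoch_nth_0 fls_times_fps_to_fls fps_to_fls_qpoch)
qed

lemma termB_fps_to_fls:
  fixes w x Q :: "'a::comm_ring_1 fps"
  assumes "w $ 0 = 0" "x $ 0 = 0" "Q $ 0 = 0"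
  shows "fps_to_fls x * fps_to_fls Q ^ n * qpoch (fps_to_fls w) (fps_to_fls Q) n
      \<oslash> (qpoch (fps_to_fls Q) (fps_to_fls Q) n * qpoch (fps_to_fls x) (fps_to_fls Q) (n + 1))
    = fps_to_fls (termB w x Q n)"
proof -
  have "fps_to_fls (qpoch Q Q n * qpoch x Q (n + 1)) =
    qpoch (fps_to_fls Q) (fps_to_fls Q) n * qpoch (fps_to_fls x) (fps_to_fls Q) (n + 1)"
    by (simp add: fls_times_fps_to_fls fps_to_fls_qpoch)
  then show ?thesis
    using assms fls_quot_fps[of "qpoch Q Q n * qpoch x Q (n + 1)"]
    by (simp add: qpoch_nth_0 termB_def fps_to_fls_qpoch[symmetric] fps_to_fls_power[symmetric]
        fls_times_fps_to_fls[symmetric] mult_ac)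
qed

text \<open>The frame shared by all four identities. The generating function \<open>G\<close> and
  the double sum have the same product with a denominator of constant coefficient 1, which is
  invertible, so they agree. The second conclusion splits off term 0 of the first series, as the
  fourth identity requires.\<close>

lemma qpoch_identity:
  fixes w x Q G :: "'a::comm_ring_1 fps" and F :: "'b \<Rightarrow> 'a fls" and A B :: "nat \<Rightarrow> 'a fls"
  assumes zero: "w $ 0 = 0" "x $ 0 = 0" "Q $ 0 = 0"
    and G: "G * (qpoch_inf x Q * qpoch_inf Q Q) = qpoch_inf w Q"
    and F: "(F has_sum fps_to_fls G) P"
    and fls: "wl = fps_to_fls w" "xl = fps_to_fls x" "Ql = fps_to_fls Q"
    and w': "w' * Ql = wl"
    and A: "\<And>n. A n = Ql ^ n * qpoch w' Ql n \<oslash> (qpoch Ql Ql n * qpoch xl Ql n)"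
    and B: "\<And>n. B n = xl * Ql ^ n * qpoch wl Ql n \<oslash> (qpoch Ql Ql n * qpoch xl Ql (n + 1))"
  defines "R \<equiv> qpoch_inf wl Ql \<oslash> (qpoch_inf xl Ql * qpoch_inf Ql Ql)"
  shows "F summable_on P \<and> summable A \<and> summable B \<and>
      infsum F P = suminf A + suminf B \<and> suminf A + suminf B = R"
    and "F summable_on P \<and> summable (\<lambda>n. A (Suc n)) \<and> summable B \<and>
      infsum F P = 1 + (\<Sum>n. A (Suc n)) + suminf B \<and> 1 + (\<Sum>n. A (Suc n)) + suminf B = R"
proof -
  define SA where "SA = (\<Sum>n. termA w x Q (Suc n))"
  define SB where "SB = (\<Sum>n. termB w x Q n)"
  define D where "D = qpoch_inf x Q * qpoch_inf Q Q"
  have A': "A = (\<lambda>n. fps_to_fls (termA w x Q n))" and B': "B = (\<lambda>n. fps_to_fls (termB w x Q n))"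
    using A B termA_fps_to_fls[OF zero w'[unfolded fls]] termB_fps_to_fls[OF zero] by (auto simp: fls)
  have sA: "A sums fps_to_fls (1 + SA)"
    unfolding A' SA_def by (intro sums_fps_to_fls sums_termA zero)
  have sA': "(\<lambda>n. A (Suc n)) sums fps_to_fls SA"
    unfolding A' SA_def by (intro sums_fps_to_fls summable_sums summable_termA zero)
  have sB: "B sums fps_to_fls SB"
    unfolding B' SB_def by (intro sums_fps_to_fls summable_sums summable_termB zero)
  have D0: "D $ 0 = 1"
    by (simp add: D_def qpoch_inf_nth_0 zero)
  have S: "(1 + SA + SB) * D = qpoch_inf w Q"
    unfolding SA_def SB_def D_def by (rule telescope_limit[OF zero])
  then have S': "1 + SA + SB = qpoch_inf w Q * fps_recip D"
    using fps_recip[OF D0] by (metis mult.assoc mult_1_right)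
  have "G = qpoch_inf w Q * fps_recip D"
    using G fps_recip[OF D0] unfolding D_def by (metis mult.assoc mult_1_right)
  with S' have GS: "G = 1 + SA + SB" by simp
  have R: "R = fps_to_fls (1 + SA + SB)"
    unfolding R_def S' fls using fls_quot_fps[OF D0, of "fps_to_fls (qpoch_inf w Q)"]
    by (simp add: qpoch_inf_fps_to_fls zero D_def flip: fls_times_fps_to_fls)
  have F': "F summable_on P" "infsum F P = fps_to_fls (1 + SA + SB)"
    using F GS by (auto simp: has_sum_imp_summable infsumI)
  show "F summable_on P \<and> summable A \<and> summable B \<and>
      infsum F P = suminf A + suminf B \<and> suminf A + suminf B = R"
    using F' R sA sB by (auto simp: sums_iff)
  show "F summable_on P \<and> summable (\<lambda>n. A (Suc n)) \<and> summable B \<and>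
      infsum F P = 1 + (\<Sum>n. A (Suc n)) + suminf B \<and> 1 + (\<Sum>n. A (Suc n)) + suminf B = R"
    using F' R sA' sB by (auto simp: sums_iff)
qed

section \<open>Generating functions\<close>

text \<open>The sum of z^(v a) q^(u a) over \<open>A\<close>, defined coefficientwise so that
  convergence is no issue. Since a sum over an infinite set defaults to 0, it has this meaning only
  if all fibres of \<open>u\<close> are finite, which is \<open>finite_fibers\<close>.\<close>

definition gen_fun :: "'r::comm_ring_1 \<Rightarrow> 'b set \<Rightarrow> ('b \<Rightarrow> nat) \<Rightarrow> ('b \<Rightarrow> nat) \<Rightarrow> 'r fps" where
  "gen_fun z A u v = Abs_fps (\<lambda>n. \<Sum>a | a \<in> A \<and> u a = n. z ^ v a)"

definition finite_fibers :: "'b set \<Rightarrow> ('b \<Rightarrow> nat) \<Rightarrow> bool" where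
  "finite_fibers A u \<longleftrightarrow> (\<forall>n. finite {a \<in> A. u a = n})"

lemma gen_fun_nth: "gen_fun z A u v $ n = (\<Sum>a | a \<in> A \<and> u a = n. z ^ v a)"
  by (simp add: gen_fun_def)

lemma finite_fibers_finite: "finite A \<Longrightarrow> finite_fibers A u"
  by (simp add: finite_fibers_def)

lemma gen_fun_finite:
  assumes "finite A"
  shows "gen_fun z A u v = (\<Sum>a\<in>A. fps_const (z ^ v a) * fps_X ^ u a)"
proof (rule fps_ext)
  fix n
  have "(\<Sum>a | a \<in> A \<and> u a = n. z ^ v a) = (\<Sum>a\<in>A. if u a = n then z ^ v a else 0)"
    using assms by (intro sum.mono_neutral_cong_left) auto
  then show "gen_fun z A u v $ n = (\<Sum>a\<in>A. fps_const (z ^ v a) * fps_X ^ u a) $ n"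
    by (auto simp: gen_fun_nth fps_sum_nth fps_X_power_nth intro!: sum.cong)
qed

text \<open>Coefficient \<open>n\<close> has its final value as soon as a finite subset of
  \<open>A\<close> contains the finite fibre over \<open>n\<close>. This links the coefficientwise
  series to the unordered infinite sum of the theorem.\<close>

lemma has_sum_gen_fun:
  assumes "finite_fibers A u"
  shows "((\<lambda>a. fls_const z ^ v a * fls_X ^ u a) has_sum fps_to_fls (gen_fun z A u v)) A"
proof -
  have "((\<lambda>X. gen_fun z X u v) \<longlongrightarrow> gen_fun z A u v) (finite_subsets_at_top A)"
  proof (rule tendsto_fpsI)
    fix n
    have "gen_fun z X u v $ n = gen_fun z A u v $ n"
      if "{a \<in> A. u a = n} \<subseteq> X" "X \<subseteq> A" for X
    proof -
      have "{a. a \<in> X \<and> u a = n} = {a. a \<in> A \<and> u a = n}" using that by auto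
      then show ?thesis by (simp add: gen_fun_nth)
    qed
    moreover have "finite {a \<in> A. u a = n}"
      using assms by (simp add: finite_fibers_def)
    ultimately show "\<forall>\<^sub>F X in finite_subsets_at_top A. gen_fun z X u v $ n = gen_fun z A u v $ n"
      unfolding eventually_finite_subsets_at_top by blast
  qed
  then have "((\<lambda>X. fps_to_fls (gen_fun z X u v)) \<longlongrightarrow> fps_to_fls (gen_fun z A u v))
    (finite_subsets_at_top A)"
    by (rule tendsto_fps_to_fls)
  moreover have "\<forall>\<^sub>F X in finite_subsets_at_top A.
      fps_to_fls (gen_fun z X u v) = (\<Sum>a\<in>X. fls_const z ^ v a * fls_X ^ u a)"
    by (rule eventually_finite_subsets_at_top_weakI)
      (simp add: gen_fun_finite fps_to_fls_sum fls_times_fps_to_fls fps_to_fls_power fls_const_power)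
  ultimately show ?thesis
    unfolding has_sum_def by (rule Lim_transform_eventually)
qed

lemma gen_fun_bij:
  assumes h: "bij_betw h A B" and eq: "\<And>a. a \<in> A \<Longrightarrow> u (h a) = u' a" "\<And>a. a \<in> A \<Longrightarrow> v (h a) = v' a"
  shows "gen_fun z B u v = gen_fun z A u' v'"
proof (rule fps_ext)
  fix n
  have "bij_betw h {a \<in> A. u' a = n} {b \<in> B. u b = n}"
    using h eq(1) by (auto simp: bij_betw_def inj_on_def)
  then have "(\<Sum>b | b \<in> B \<and> u b = n. z ^ v b) = (\<Sum>a | a \<in> A \<and> u' a = n. z ^ v (h a))"
    by (rule sum.reindex_bij_betw[symmetric])
  then show "gen_fun z B u v $ n = gen_fun z A u' v' $ n"
    by (simp add: gen_fun_nth eq(2))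
qed

lemma finite_fibers_bij:
  assumes "bij_betw h A B" "\<And>a. a \<in> A \<Longrightarrow> u (h a) = u' a" "finite_fibers A u'"
  shows "finite_fibers B u"
  unfolding finite_fibers_def
proof
  fix n
  have "{b \<in> B. u b = n} = h ` {a \<in> A. u' a = n}"
    using assms(1,2) by (auto simp: bij_betw_def)
  then show "finite {b \<in> B. u b = n}"
    using assms(3) by (simp add: finite_fibers_def)
qed

lemma fibers_Times:
  fixes u u' :: "_ \<Rightarrow> nat"
  shows "{p. p \<in> A \<times> B \<and> u (fst p) + u' (snd p) = n}
    = (\<Union>i\<in>{0..n}. {a \<in> A. u a = i} \<times> {b \<in> B. u' b = n - i})"
  by auto

lemma finite_fibers_Times:
  assumes "finite_fibers A u" "finite_fibers B u'"
  shows "finite_fibers (A \<times> B) (\<lambda>p. u (fst p) + u' (snd p))"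
  using assms by (simp add: finite_fibers_def fibers_Times)

text \<open>The fibre over \<open>n\<close> is the disjoint union of the products of the fibres over
  \<open>i\<close> and \<open>n - i\<close>, which is the Cauchy product.\<close>

lemma gen_fun_Times:
  assumes "finite_fibers A u" "finite_fibers B u'"
  shows "gen_fun z (A \<times> B) (\<lambda>p. u (fst p) + u' (snd p)) (\<lambda>p. v (fst p) + v' (snd p))
    = gen_fun z A u v * gen_fun z B u' v'"
proof (rule fps_ext)
  fix n
  have "gen_fun z (A \<times> B) (\<lambda>p. u (fst p) + u' (snd p)) (\<lambda>p. v (fst p) + v' (snd p)) $ n
    = (\<Sum>i=0..n. \<Sum>p\<in>{a \<in> A. u a = i} \<times> {b \<in> B. u' b = n - i}. z ^ (v (fst p) + v' (snd p)))"
    unfolding gen_fun_nth fibers_Times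
    using assms by (intro sum.UNION_disjoint) (auto simp: finite_fibers_def)
  also have "\<dots> = (gen_fun z A u v * gen_fun z B u' v') $ n"
    by (simp add: fps_mult_nth gen_fun_nth sum_product sum.cartesian_product power_add split_beta)
  finally show "gen_fun z (A \<times> B) (\<lambda>p. u (fst p) + u' (snd p)) (\<lambda>p. v (fst p) + v' (snd p)) $ n
    = (gen_fun z A u v * gen_fun z B u' v') $ n" .
qed

lemma fibers_nat:
  assumes "0 < (c::nat)"
  shows "{k. c * k = n} = (if c dvd n then {n div c} else {})"
  using assms by auto

lemma finite_fibers_nat: "0 < c \<Longrightarrow> finite_fibers UNIV (\<lambda>k. c * k)"
  by (simp add: finite_fibers_def fibers_nat)

text \<open>The geometric series 1 / (1 - z^d q^c) with the denominator cleared: subtracting z^d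
  times the shift by \<open>c\<close> cancels every coefficient except the one at 0.\<close>

lemma gen_fun_nat:
  assumes "0 < c"
  shows "gen_fun z UNIV (\<lambda>k. c * k) (\<lambda>k. d * k) * (1 - fps_const (z ^ d) * fps_X ^ c) = 1"
proof (rule fps_ext)
  fix n
  let ?G = "gen_fun z UNIV (\<lambda>k. c * k) (\<lambda>k. d * k)"
  have G: "?G $ n = (if c dvd n then z ^ (d * (n div c)) else 0)" for n
    using assms by (simp add: gen_fun_nth fibers_nat)
  have "?G * (1 - fps_const (z ^ d) * fps_X ^ c) = ?G - fps_const (z ^ d) * (fps_X ^ c * ?G)"
    by (simp add: algebra_simps)
  then have "(?G * (1 - fps_const (z ^ d) * fps_X ^ c)) $ n
    = ?G $ n - z ^ d * (if n < c then 0 else ?G $ (n - c))"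
    by (simp add: fps_X_power_mult_nth)
  also have "\<dots> = 1 $ n"
  proof (cases "n < c")
    case True
    then show ?thesis using assms by (auto simp: G dest: dvd_imp_le)
  next
    case False
    then have "n = (n - c) + c" by simp
    then obtain m where "n = m + c" by blast
    then show ?thesis using assms by (simp add: G power_add)
  qed
  finally show "(?G * (1 - fps_const (z ^ d) * fps_X ^ c)) $ n = 1 $ n" .
qed

section \<open>Partitions and their differences\<close>

text \<open>The difference \<open>m i\<close> of two neighbouring parts is the multiplicity of \<open>i + 1\<close> in the
  conjugate partition.\<close>

definition diff_seqs :: "bool \<Rightarrow> nat \<Rightarrow> (nat \<Rightarrow> nat) set" where
  "diff_seqs p k = {m. (\<forall>i\<ge>k. m i = 0) \<and> (\<forall>i. even i = p \<longrightarrow> even (m i + m (Suc i)))}"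

text \<open>When \<open>C\<close> lists the partial sums of the coefficients of a weight, this is
  that weight in terms of the differences of the partition.\<close>

definition lin :: "(nat \<Rightarrow> nat) \<Rightarrow> nat \<Rightarrow> (nat \<Rightarrow> nat) \<Rightarrow> nat" where
  "lin C k m = (\<Sum>i<k. C i * m i)"

text \<open>The parity conditions couple disjoint pairs of positions. As \<open>k\<close> has the
  parity of \<open>p\<close>, the new positions \<open>k\<close> and \<open>Suc k\<close> form one
  such pair: they are independent of the earlier ones and restricted only by having equal parity,
  recorded by \<open>e\<close>.\<close>

lemma bij_diff_seqs_step:
  assumes k: "even k = p"
  shows "bij_betw (\<lambda>(m, a, b, e). m(k := 2 * a + of_bool e, Suc k := 2 * b + of_bool e))
    (diff_seqs p k \<times> UNIV) (diff_seqs p (k + 2))"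
proof (rule bij_betw_byWitness[where f' = "\<lambda>m. (m(k := 0, Suc k := 0), m k div 2, m (Suc k) div 2, odd (m k))"])
  show "\<forall>t\<in>diff_seqs p k \<times> UNIV. (\<lambda>m. (m(k := 0, Suc k := 0), m k div 2, m (Suc k) div 2, odd (m k)))
      ((\<lambda>(m, a, b, e). m(k := 2 * a + of_bool e, Suc k := 2 * b + of_bool e)) t) = t"
    by (auto simp: diff_seqs_def fun_eq_iff)
  show "\<forall>m\<in>diff_seqs p (k + 2). (\<lambda>(m, a, b, e). m(k := 2 * a + of_bool e, Suc k := 2 * b + of_bool e))
      ((\<lambda>m. (m(k := 0, Suc k := 0), m k div 2, m (Suc k) div 2, odd (m k))) m) = m"
  proof
    fix m assume "m \<in> diff_seqs p (k + 2)"
    then have "even (m k + m (Suc k))" using k by (auto simp: diff_seqs_def)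
    then have par: "odd (m k) = odd (m (Suc k))" by auto
    have half: "2 * (n div 2) + of_bool (odd n) = n" for n :: nat
      by (cases "odd n") auto
    \<comment> \<open>The bit is read off from \<open>m k\<close> only; by \<open>par\<close> it
      also serves \<open>m (Suc k)\<close>.\<close>
    have "2 * (m k div 2) + of_bool (odd (m k)) = m k"
      "2 * (m (Suc k) div 2) + of_bool (odd (m k)) = m (Suc k)"
      by (rule half, unfold par, rule half)
    then show "(\<lambda>(m, a, b, e). m(k := 2 * a + of_bool e, Suc k := 2 * b + of_bool e))
      ((\<lambda>m. (m(k := 0, Suc k := 0), m k div 2, m (Suc k) div 2, odd (m k))) m) = m"
      by (simp add: fun_upd_idem_iff)
  qed
  show "(\<lambda>(m, a, b, e). m(k := 2 * a + of_bool e, Suc k := 2 * b + of_bool e)) ` (diff_seqs p k \<times> UNIV)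
      \<subseteq> diff_seqs p (k + 2)"
  proof clarify
    fix m a b e assume m: "m \<in> diff_seqs p k"
    let ?m = "m(k := 2 * a + of_bool e, Suc k := 2 * b + of_bool e)"
    have "?m i = 0" if "i \<ge> k + 2" for i
      using m that by (simp add: diff_seqs_def)
    moreover have "even (?m i + ?m (Suc i))" if "even i = p" for i
    proof (cases "i = k")
      case False
      \<comment> \<open>A constrained index has the parity of \<open>k\<close>, so no other pair
        meets the updated positions.\<close>
      have "i \<noteq> Suc k" "Suc i \<noteq> k" using that k by auto
      with False have "?m i = m i" "?m (Suc i) = m (Suc i)" by auto
      then show ?thesis using m that unfolding diff_seqs_def by auto
    qed simp
    ultimately show "?m \<in> diff_seqs p (k + 2)" by (simp only: diff_seqs_def mem_Collect_eq) blast
  qed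
  show "(\<lambda>m. (m(k := 0, Suc k := 0), m k div 2, m (Suc k) div 2, odd (m k))) ` diff_seqs p (k + 2)
      \<subseteq> diff_seqs p k \<times> UNIV"
  proof (intro image_subsetI SigmaI UNIV_I)
    fix m assume m: "m \<in> diff_seqs p (k + 2)"
    have "(m(k := 0, Suc k := 0)) i = 0" if "i \<ge> k" for i
    proof (cases "i = k \<or> i = Suc k")
      case False
      with that have "i \<ge> k + 2" by auto
      with m show ?thesis by (simp add: diff_seqs_def)
    qed auto
    moreover have "even ((m(k := 0, Suc k := 0)) i + (m(k := 0, Suc k := 0)) (Suc i))" if "even i = p" for i
    proof -
      have "i \<noteq> Suc k" "Suc i \<noteq> k" using that k by auto
      moreover have "even (m i + m (Suc i))" using m that by (simp add: diff_seqs_def)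
      ultimately show ?thesis by auto
    qed
    ultimately show "m(k := 0, Suc k := 0) \<in> diff_seqs p k" by (simp add: diff_seqs_def)
  qed
qed

lemma lin_step:
  "lin C (k + 2) (m(k := x, Suc k := y)) = lin C k m + (C k * x + C (Suc k) * y)"
  by (simp add: lin_def)

lemma gen_fun_bool:
  "gen_fun z UNIV (\<lambda>e. c * of_bool e) (\<lambda>e. d * of_bool e) = 1 + fps_const (z ^ d) * fps_X ^ c"
  by (simp add: gen_fun_finite UNIV_bool)

text \<open>By \<open>bij_diff_seqs_step\<close> the generating function acquires a geometric series
  for each of \<open>a\<close> and \<open>b\<close> and a two-term factor for the shared bit
  \<open>e\<close>. The geometric series are moved to the left as denominators.\<close>

lemma gen_fun_diff_seqs_step:
  fixes z :: "'a::comm_ring_1"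
  assumes k: "even k = p" and C: "0 < C k" "0 < C (Suc k)" and fin: "finite_fibers (diff_seqs p k) (lin C k)"
  shows "gen_fun z (diff_seqs p (k + 2)) (lin C (k + 2)) (lin d (k + 2))
      * ((1 - fps_const (z ^ (2 * d k)) * fps_X ^ (2 * C k))
        * (1 - fps_const (z ^ (2 * d (Suc k))) * fps_X ^ (2 * C (Suc k))))
    = gen_fun z (diff_seqs p k) (lin C k) (lin d k)
      * (1 + fps_const (z ^ (d k + d (Suc k))) * fps_X ^ (C k + C (Suc k)))"
proof -
  define Ga where "Ga = gen_fun z UNIV (\<lambda>a. 2 * C k * a) (\<lambda>a. 2 * d k * a)"
  define Gb where "Gb = gen_fun z UNIV (\<lambda>a. 2 * C (Suc k) * a) (\<lambda>a. 2 * d (Suc k) * a)"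
  define Ge where "Ge = gen_fun z UNIV (\<lambda>e. (C k + C (Suc k)) * of_bool e) (\<lambda>e. (d k + d (Suc k)) * of_bool e)"
  have fa: "finite_fibers UNIV (\<lambda>a. 2 * C k * a)" and fb: "finite_fibers UNIV (\<lambda>a. 2 * C (Suc k) * a)"
    using C by (auto intro: finite_fibers_nat)
  have fe: "finite_fibers (UNIV :: bool set) (\<lambda>e. (C k + C (Suc k)) * of_bool e)"
    by (simp add: finite_fibers_finite)
  note fbe = finite_fibers_Times[OF fb fe]
  note fabe = finite_fibers_Times[OF fa fbe]
  have "gen_fun z (diff_seqs p (k + 2)) (lin C (k + 2)) (lin d (k + 2))
    = gen_fun z (diff_seqs p k) (lin C k) (lin d k) * (Ga * (Gb * Ge))"
    unfolding Ga_def Gb_def Ge_def gen_fun_Times[OF fb fe, symmetric] gen_fun_Times[OF fa fbe, symmetric]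
      gen_fun_Times[OF fin fabe, symmetric]
    unfolding UNIV_Times_UNIV
    by (rule gen_fun_bij[OF bij_diff_seqs_step[OF k]])
      (simp_all only: split_beta lin_step, simp_all add: algebra_simps)
  moreover have "Ga * (1 - fps_const (z ^ (2 * d k)) * fps_X ^ (2 * C k)) = 1"
    "Gb * (1 - fps_const (z ^ (2 * d (Suc k))) * fps_X ^ (2 * C (Suc k))) = 1"
    using C by (simp_all add: Ga_def Gb_def gen_fun_nat)
  moreover have "Ge = 1 + fps_const (z ^ (d k + d (Suc k))) * fps_X ^ (C k + C (Suc k))"
    unfolding Ge_def by (rule gen_fun_bool)
  moreover have "G * (x * (y * w)) * (x' * y') = G * w" if "x * x' = 1" "y * y' = 1"
    for G x y w x' y' :: "'a fps"
  proof -
    have "G * (x * (y * w)) * (x' * y') = G * w * ((x * x') * (y * y'))" by (simp only: mult_ac)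
    with that show ?thesis by simp
  qed
  ultimately show ?thesis by simp
qed

lemma gen_fun_diff_seqs_0: "gen_fun z (diff_seqs p 0) (lin C 0) (lin d 0) = 1"
proof -
  have "diff_seqs p 0 = {\<lambda>_. 0}" by (auto simp: diff_seqs_def)
  then show ?thesis by (simp add: gen_fun_finite lin_def)
qed

text \<open>For \<open>p = False\<close> the pairs start at position 1, so entry 0 is free apart
  from its own splitting into 2a + e.\<close>

lemma gen_fun_diff_seqs_1:
  assumes C: "0 < C 0"
  shows "gen_fun z (diff_seqs False 1) (lin C 1) (lin d 1) * (1 - fps_const (z ^ (2 * d 0)) * fps_X ^ (2 * C 0))
    = 1 + fps_const (z ^ d 0) * fps_X ^ C 0"
proof -
  define Ga where "Ga = gen_fun z UNIV (\<lambda>a. 2 * C 0 * a) (\<lambda>a. 2 * d 0 * a)"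
  define Ge where "Ge = gen_fun z UNIV (\<lambda>e. C 0 * of_bool e) (\<lambda>e. d 0 * of_bool e)"
  have fa: "finite_fibers UNIV (\<lambda>a. 2 * C 0 * a)"
    using C by (auto intro: finite_fibers_nat)
  have fe: "finite_fibers (UNIV :: bool set) (\<lambda>e. C 0 * of_bool e)"
    by (simp add: finite_fibers_finite)
  have "bij_betw (\<lambda>(a, e) i. if i = 0 then 2 * a + of_bool e else 0) UNIV (diff_seqs False 1)"
    by (rule bij_betw_byWitness[where f' = "\<lambda>m. (m 0 div 2, odd (m 0))"])
      (auto simp: diff_seqs_def fun_eq_iff Suc_le_eq odd_iff_mod_2_eq_one)
  then have "gen_fun z (diff_seqs False 1) (lin C 1) (lin d 1) = Ga * Ge"
    unfolding Ga_def Ge_def gen_fun_Times[OF fa fe, symmetric]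
    unfolding UNIV_Times_UNIV
    by (rule gen_fun_bij) (auto simp: lin_def algebra_simps)
  moreover have "Ga * (1 - fps_const (z ^ (2 * d 0)) * fps_X ^ (2 * C 0)) = 1"
    using C by (simp add: Ga_def gen_fun_nat)
  moreover have "Ge = 1 + fps_const (z ^ d 0) * fps_X ^ C 0"
    unfolding Ge_def by (rule gen_fun_bool)
  ultimately show ?thesis by (metis mult.assoc mult.commute mult_1_right)
qed

section \<open>Recovering a partition from its differences\<close>

definition steps :: "nat list \<Rightarrow> nat \<Rightarrow> nat" where
  "steps xs i = nth_default 0 xs i - nth_default 0 xs (Suc i)"

text \<open>Padding a partition with zeros keeps it decreasing, so the natural subtraction in
  \<open>steps\<close> never truncates.\<close>

lemma antimono_nth_default:
  assumes "xs \<in> partitions"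
  shows "antimono (nth_default 0 xs)"
  using assms by (intro decseq_SucI) (auto simp: partitions_def nth_default_def sorted_wrt_iff_nth_less)

text \<open>The differences telescope down from the padded part at \<open>k\<close>, which is
  0.\<close>

lemma nth_default_conv_steps:
  assumes "xs \<in> partitions" "length xs \<le> k"
  shows "nth_default 0 xs i = (\<Sum>j\<in>{i..<k}. steps xs j)"
proof (cases "i \<le> k")
  case True
  then show ?thesis
  proof (induction rule: inc_induct)
    case base
    show ?case using assms by (simp add: nth_default_def)
  next
    case (step i)
    have "nth_default 0 xs (Suc i) \<le> nth_default 0 xs i"
      using antimono_nth_default[OF assms(1)] by (simp add: antimono_def)
    with step show ?case
      by (simp add: sum.atLeast_Suc_lessThan steps_def)
  qed
qed (use assms in \<open>simp add: nth_default_def\<close>)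

text \<open>Treats both classes at once: \<open>p = False\<close> gives \<open>P1'\<close> and
  \<open>p = True\<close> gives \<open>P2'\<close>.\<close>

definition parity_partitions :: "bool \<Rightarrow> nat list set" where
  "parity_partitions p = {xs \<in> partitions. \<forall>i<length xs. even i = p \<longrightarrow> even (xs ! i)}"

text \<open>The tail sums of the differences give back the padded parts; since parts are positive,
  the length is the first index at which the padded sequence vanishes.\<close>

lemma inj_steps: "inj_on steps {xs \<in> parity_partitions p. length xs \<le> k}"
proof (rule inj_onI)
  fix xs ys
  assume xs: "xs \<in> {xs \<in> parity_partitions p. length xs \<le> k}"
    and ys: "ys \<in> {xs \<in> parity_partitions p. length xs \<le> k}" and eq: "steps xs = steps ys"
  have nd: "nth_default 0 xs i = nth_default 0 ys i" for i
    using xs ys eq nth_default_conv_steps[of xs k i] nth_default_conv_steps[of ys k i]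
    by (simp add: parity_partitions_def)
  have pos: "nth_default 0 zs i = 0 \<longleftrightarrow> length zs \<le> i" if "zs \<in> partitions" for zs and i :: nat
    using that by (auto simp: partitions_def nth_default_def dest: nth_mem)
  have "length xs \<le> i \<longleftrightarrow> length ys \<le> i" for i
    using pos[of xs i] pos[of ys i] nd xs ys by (auto simp: parity_partitions_def)
  then have len: "length xs = length ys" by (metis order_antisym order_refl)
  show "xs = ys"
    by (rule nth_equalityI[OF len]) (use nd len in \<open>simp add: nth_default_def, metis\<close>)
qed

text \<open>Two neighbouring differences add up to the difference of two parts at distance 2, both
  of the constrained parity of position.\<close>

lemma steps_parity:
  assumes "xs \<in> parity_partitions p" "even i = p"
  shows "even (steps xs i + steps xs (Suc i))"
proof -
  have "xs \<in> partitions" using assms by (simp add: parity_partitions_def)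
  then have "nth_default 0 xs (Suc i) \<le> nth_default 0 xs i" "nth_default 0 xs (Suc (Suc i)) \<le> nth_default 0 xs (Suc i)"
    using antimono_nth_default by (auto simp: antimono_def)
  then have "steps xs i + steps xs (Suc i) = nth_default 0 xs i - nth_default 0 xs (Suc (Suc i))"
    by (simp add: steps_def)
  \<comment> \<open>Past the end of the list the default 0 is even as well.\<close>
  moreover have "even (nth_default 0 xs i)" "even (nth_default 0 xs (Suc (Suc i)))"
    using assms by (auto simp: parity_partitions_def nth_default_def)
  ultimately show ?thesis by simp
qed

text \<open>Entries are removed in pairs with even sum. This is the converse of
  \<open>steps_parity\<close>, needed for surjectivity.\<close>

lemma even_tail_sum:
  assumes m: "m \<in> diff_seqs p k" and "even i = p"
  shows "even (\<Sum>j\<in>{i..<k}. m j)"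
  using \<open>even i = p\<close>
proof (induction "k - i" arbitrary: i rule: less_induct)
  case less
  \<comment> \<open>If the last pair starts at \<open>k - 1\<close>, its partner is this zero, so
    the leftover entry is even.\<close>
  have z: "m k = 0" using m by (simp add: diff_seqs_def)
  consider "k \<le> i" | "Suc i = k" | "Suc (Suc i) \<le> k" by linarith
  then show ?case
  proof cases
    case 2
    then show ?thesis using m z less.prems by (auto simp: diff_seqs_def)
  next
    case 3
    then have "(\<Sum>j\<in>{i..<k}. m j) = (m i + m (Suc i)) + (\<Sum>j\<in>{Suc (Suc i)..<k}. m j)"
      by (simp add: sum.atLeast_Suc_lessThan)
    moreover have "even (\<Sum>j\<in>{Suc (Suc i)..<k}. m j)"
      using 3 less.prems by (intro less.hyps) auto
    moreover have "even (m i + m (Suc i))"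
      using m less.prems by (simp add: diff_seqs_def)
    ultimately show ?thesis by simp
  qed simp
qed

lemma bij_steps:
  "bij_betw steps {xs \<in> parity_partitions p. length xs \<le> k} (diff_seqs p k)"
proof -
  have "steps ` {xs \<in> parity_partitions p. length xs \<le> k} \<subseteq> diff_seqs p k"
    using steps_parity by (auto simp: diff_seqs_def) (auto simp: steps_def nth_default_def)
  moreover have "\<exists>xs. xs \<in> parity_partitions p \<and> length xs \<le> k \<and> steps xs = m" if m: "m \<in> diff_seqs p k" for m
  proof -
    define f where "f i = (\<Sum>j\<in>{i..<k}. m j)" for i
    \<comment> \<open>The parts are the tail sums \<open>f\<close>. As \<open>f\<close> is
      decreasing, cutting at its first zero removes all zeros and leaves positive parts.\<close>
    define l where "l = (LEAST i. f i = 0)"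
    define xs where "xs = map f [0..<l]"
    have fk: "f k = 0" by (simp add: f_def)
    have fl: "f l = 0" unfolding l_def by (rule LeastI[of "\<lambda>i. f i = 0", OF fk])
    have lk: "l \<le> k" unfolding l_def by (rule Least_le) (rule fk)
    have pos: "0 < f i" if "i < l" for i
      using that not_less_Least[of i "\<lambda>i. f i = 0"] by (auto simp: l_def)
    have mono: "f j \<le> f i" if "i \<le> j" for i j
      unfolding f_def using that by (intro sum_mono2) auto
    have nd: "nth_default 0 xs i = f i" for i
      using mono[of l i] fl by (auto simp: nth_default_def xs_def)
    have "steps xs = m"
    proof
      fix i
      have "f i = m i + f (Suc i)"
        using m by (cases "i < k") (auto simp: f_def sum.atLeast_Suc_lessThan diff_seqs_def)
      then show "steps xs i = m i" by (simp add: steps_def nd)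
    qed
    moreover have "sorted_wrt (\<ge>) xs"
      unfolding sorted_wrt_iff_nth_less xs_def using mono by simp
    moreover have "\<forall>x\<in>set xs. 0 < x"
      using pos by (simp add: xs_def)
    moreover have "even (f i)" if "even i = p" for i
      unfolding f_def using m that by (rule even_tail_sum)
    then have "\<forall>i<length xs. even i = p \<longrightarrow> even (xs ! i)"
      by (simp add: xs_def)
    moreover have "length xs \<le> k" using lk by (simp add: xs_def)
    ultimately show ?thesis
      unfolding parity_partitions_def partitions_def by blast
  qed
  ultimately show ?thesis using inj_steps[of p k] unfolding bij_betw_def by blast
qed

section \<open>Statistics as linear forms in the differences\<close>

lemma sum_by_diffs:
  fixes c f :: "nat \<Rightarrow> 'a::comm_ring_1"
  shows "(\<Sum>i<k. c i * f i) = (\<Sum>i<k. (\<Sum>j\<le>i. c j) * (f i - f (Suc i))) + (\<Sum>i<k. c i) * f k"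
proof (induction k)
  case (Suc k)
  show ?case by (simp add: Suc lessThan_Suc_atMost[symmetric] algebra_simps)
qed simp

text \<open>Abel summation, whose boundary term vanishes because the padded part at \<open>k\<close>
  is 0. Integer coefficients admit the alternating signs too.\<close>

lemma weight_conv_steps_int:
  fixes c :: "nat \<Rightarrow> int"
  assumes "xs \<in> partitions" "length xs \<le> k"
  shows "(\<Sum>i<length xs. c i * int (xs ! i)) = (\<Sum>i<k. (\<Sum>j\<le>i. c j) * int (steps xs i))"
proof -
  have "(\<Sum>i<length xs. c i * int (xs ! i)) = (\<Sum>i<k. c i * int (nth_default 0 xs i))"
    using assms(2) by (intro sum.mono_neutral_cong_left) (auto simp: nth_default_def)
  also have "\<dots> = (\<Sum>i<k. (\<Sum>j\<le>i. c j) * (int (nth_default 0 xs i) - int (nth_default 0 xs (Suc i))))"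
    using assms(2) by (subst sum_by_diffs) (simp add: nth_default_def)
  also have "\<dots> = (\<Sum>i<k. (\<Sum>j\<le>i. c j) * int (steps xs i))"
    using antimono_nth_default[OF assms(1)]
    by (intro sum.cong) (auto simp: steps_def antimono_def of_nat_diff)
  finally show ?thesis .
qed

definition weight :: "(nat \<Rightarrow> nat) \<Rightarrow> nat list \<Rightarrow> nat" where
  "weight c xs = (\<Sum>i<length xs. c i * xs ! i)"

lemma weight_conv_steps:
  assumes "xs \<in> partitions" "length xs \<le> k"
  shows "lin (\<lambda>i. \<Sum>j\<le>i. c j) k (steps xs) = weight c xs"
proof -
  have "int (weight c xs) = int (lin (\<lambda>i. \<Sum>j\<le>i. c j) k (steps xs))"
    using weight_conv_steps_int[OF assms, of "\<lambda>i. int (c i)"] by (simp add: weight_def lin_def)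
  then show ?thesis by simp
qed

text \<open>The partial sums of (-1)^j are 1, 0, 1, 0, ..., so only the differences at even
  positions count.\<close>

lemma alt_sum_conv_steps:
  assumes "xs \<in> partitions" "length xs \<le> k"
  shows "lin (\<lambda>i. of_bool (even i)) k (steps xs) = nat (alt_sum xs)"
proof -
  have "(\<Sum>j\<le>i. (- 1) ^ j :: int) = of_bool (even i)" for i :: nat
    by (induction i) auto
  then have "alt_sum xs = int (lin (\<lambda>i. of_bool (even i)) k (steps xs))"
    using weight_conv_steps_int[OF assms, of "\<lambda>i. (- 1) ^ i"] by (simp add: alt_sum_def lin_def)
  then show ?thesis by simp
qed

section \<open>The generating functions of the two classes\<close>

text \<open>A partition with \<open>u xs = n\<close> has length at most 2n, so a bound on the length
  no longer affects coefficient \<open>n\<close> once N is at least 2n. The function \<kappa> lets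
  the bound run through even or odd lengths only.\<close>

lemma gen_fun_tendsto:
  assumes len: "\<And>xs. xs \<in> P \<Longrightarrow> length xs \<le> 2 * u xs" and \<kappa>: "\<And>N. N \<le> \<kappa> N"
  shows "(\<lambda>N. gen_fun z {xs \<in> P. length xs \<le> \<kappa> N} u v) \<longlonglongrightarrow> gen_fun z P u v"
proof (rule tendsto_fpsI)
  fix n
  have "gen_fun z {xs \<in> P. length xs \<le> \<kappa> N} u v $ n = gen_fun z P u v $ n" if "2 * n \<le> N" for N
  proof -
    have "{xs. xs \<in> {xs \<in> P. length xs \<le> \<kappa> N} \<and> u xs = n} = {xs. xs \<in> P \<and> u xs = n}"
      using that \<kappa>[of N] by (auto dest: len)
    then show ?thesis by (simp add: gen_fun_nth)
  qed
  then show "\<forall>\<^sub>F N in sequentially. gen_fun z {xs \<in> P. length xs \<le> \<kappa> N} u v $ n = gen_fun z P u v $ n"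
    by (rule eventually_sequentiallyI)
qed

lemma length_le_sum_list:
  assumes "xs \<in> partitions"
  shows "length xs \<le> sum_list xs"
proof -
  have "(\<forall>x\<in>set xs. 0 < x) \<Longrightarrow> length xs \<le> sum_list xs" for xs :: "nat list"
    by (induction xs) auto
  then show ?thesis using assms by (simp add: partitions_def)
qed

lemma sum_list_conv_weight: "sum_list xs = weight (\<lambda>_. 1) xs"
  by (simp add: weight_def sum_list_sum_nth atLeast0LessThan)

lemma schmidt_weight_conv_weight: "schmidt_weight xs = weight (\<lambda>i. of_bool (even i)) xs"
proof -
  have "schmidt_weight xs = (\<Sum>i\<in>{..<length xs} \<inter> {i. even i}. xs ! i)"
    unfolding schmidt_weight_def by (rule sum.cong) auto
  also have "\<dots> = weight (\<lambda>i. of_bool (even i)) xs"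
    unfolding weight_def sum.inter_restrict[OF finite_lessThan] by (rule sum.cong) auto
  finally show ?thesis .
qed

context
  fixes c C :: "nat \<Rightarrow> nat"
  assumes C: "\<And>i. C i = (\<Sum>j\<le>i. c j)" and C_lower: "\<And>i. i < 2 * C i"
begin

text \<open>In terms of differences, the size has coefficients i + 1 and the weight has coefficients
  \<open>C i\<close>; \<open>C_lower\<close> compares them one by one.\<close>

lemma sum_list_le_weight:
  assumes "xs \<in> partitions"
  shows "sum_list xs \<le> 2 * weight c xs"
proof -
  have "sum_list xs = (\<Sum>i<length xs. Suc i * steps xs i)"
    using weight_conv_steps[OF assms order_refl, of "\<lambda>_. 1"] by (simp add: sum_list_conv_weight lin_def)
  also have "\<dots> \<le> (\<Sum>i<length xs. 2 * C i * steps xs i)"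
    using C_lower by (intro sum_mono mult_right_mono) (auto simp: Suc_le_eq)
  also have "\<dots> = 2 * weight c xs"
    unfolding weight_conv_steps[OF assms order_refl, of c, symmetric]
    by (simp add: lin_def sum_distrib_left mult.assoc flip: C)
  finally show ?thesis .
qed

text \<open>A bound on the weight bounds the size, hence both the length and every part.\<close>

lemma finite_fibers_weight:
  assumes "P \<subseteq> partitions"
  shows "finite_fibers P (weight c)"
  unfolding finite_fibers_def
proof
  fix n
  have "{xs \<in> P. weight c xs = n} \<subseteq> {xs. set xs \<subseteq> {..2 * n} \<and> length xs \<le> 2 * n}"
  proof clarify
    fix xs assume xs: "xs \<in> P" and n: "n = weight c xs"
    from xs assms have "xs \<in> partitions" by auto
    then have "sum_list xs \<le> 2 * n" "length xs \<le> 2 * n"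
      using sum_list_le_weight length_le_sum_list n by fastforce+
    then show "set xs \<subseteq> {..2 * weight c xs} \<and> length xs \<le> 2 * weight c xs"
      using member_le_sum_list[of _ xs] n by fastforce
  qed
  then show "finite {xs \<in> P. weight c xs = n}"
    by (rule finite_subset) (rule finite_lists_length_le, simp)
qed

lemma parity_partitions_subset: "parity_partitions p \<subseteq> partitions"
  by (auto simp: parity_partitions_def)

text \<open>Transported from partitions along \<open>steps\<close>; supplies the finiteness assumed
  in \<open>gen_fun_diff_seqs_step\<close>.\<close>

lemma finite_fibers_diff_seqs: "finite_fibers (diff_seqs p k) (lin C k)"
proof (rule finite_fibers_bij[OF bij_steps])
  show "finite_fibers {xs \<in> parity_partitions p. length xs \<le> k} (weight c)"
    by (rule finite_fibers_weight) (auto simp: parity_partitions_def)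
  show "lin C k (steps xs) = weight c xs" if "xs \<in> {xs \<in> parity_partitions p. length xs \<le> k}" for xs
    using that weight_conv_steps[of xs k c] by (simp add: parity_partitions_def flip: C)
qed

lemma gen_fun_diff_seqs_conv:
  "gen_fun z (diff_seqs p k) (lin C k) (lin (\<lambda>i. of_bool (even i)) k)
    = gen_fun z {xs \<in> parity_partitions p. length xs \<le> k} (weight c) (\<lambda>xs. nat (alt_sum xs))"
proof (rule gen_fun_bij[OF bij_steps])
  fix xs assume "xs \<in> {xs \<in> parity_partitions p. length xs \<le> k}"
  then show "lin C k (steps xs) = weight c xs"
    and "lin (\<lambda>i. of_bool (even i)) k (steps xs) = nat (alt_sum xs)"
    using weight_conv_steps[of xs k c] alt_sum_conv_steps[of xs k]
    by (simp_all add: parity_partitions_def flip: C)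
qed

lemma parity_gen_fun_tendsto:
  assumes "\<And>N. N \<le> \<kappa> N"
  shows "(\<lambda>N. gen_fun z (diff_seqs p (\<kappa> N)) (lin C (\<kappa> N)) (lin (\<lambda>i. of_bool (even i)) (\<kappa> N)))
    \<longlonglongrightarrow> gen_fun z (parity_partitions p) (weight c) (\<lambda>xs. nat (alt_sum xs))"
  unfolding gen_fun_diff_seqs_conv
proof (rule gen_fun_tendsto[OF _ assms])
  fix xs assume "xs \<in> parity_partitions p"
  then have "xs \<in> partitions" using parity_partitions_subset by auto
  then show "length xs \<le> 2 * weight c xs"
    using length_le_sum_list sum_list_le_weight order_trans by blast
qed

lemma C_pos: "0 < C i"
  using C_lower[of i] by simp

context
  fixes z :: "'a::comm_ring_1" and w x Q :: "'a fps"
  assumes Q0: "Q $ 0 = 0"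
    and hx: "\<And>i. fps_const (z ^ 2) * fps_X ^ (2 * C (2 * i)) = x * Q ^ i"
    and hQ: "\<And>i. fps_X ^ (2 * C (2 * i + 1)) = Q * Q ^ i"
begin

text \<open>The pairs are the positions (2i, 2i + 1). Only the even position contributes to the
  alternating sum, so pair i yields the factor (1 - w Q^i) / ((1 - x Q^i)(1 - Q Q^i));
  \<open>hx\<close>, \<open>hQ\<close> and \<open>hw\<close> say exactly this. The finite products
  then tend to the infinite ones.\<close>

lemma gen_fun_P2':
  assumes hw: "\<And>i. fps_const z * fps_X ^ (C (2 * i) + C (2 * i + 1)) = - w * Q ^ i"
  shows "gen_fun z P2' (weight c) (\<lambda>xs. nat (alt_sum xs)) * (qpoch_inf x Q * qpoch_inf Q Q) = qpoch_inf w Q"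
proof -
  define G where "G k = gen_fun z (diff_seqs True k) (lin C k) (lin (\<lambda>i. of_bool (even i)) k)" for k
  have P2': "P2' = parity_partitions True"
    by (simp add: P2'_def parity_partitions_def)
  have fin: "G (2 * N) * (qpoch x Q N * qpoch Q Q N) = qpoch w Q N" for N
  proof (induction N)
    case 0
    show ?case by (simp add: G_def gen_fun_diff_seqs_0)
next
    case (Suc N)
    have step: "G (2 * Suc N) * ((1 - x * Q ^ N) * (1 - Q * Q ^ N)) = G (2 * N) * (1 - w * Q ^ N)"
      using gen_fun_diff_seqs_step[OF _ C_pos C_pos finite_fibers_diff_seqs, of "2 * N" True z "\<lambda>i. of_bool (even i)"]
      using hx[of N] hQ[of N] hw[of N] by (simp add: G_def)
    have "G (2 * Suc N) * (qpoch x Q (Suc N) * qpoch Q Q (Suc N))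
      = (G (2 * Suc N) * ((1 - x * Q ^ N) * (1 - Q * Q ^ N))) * (qpoch x Q N * qpoch Q Q N)"
      by (simp only: qpoch_Suc mult_ac)
    also have "\<dots> = (G (2 * N) * (1 - w * Q ^ N)) * (qpoch x Q N * qpoch Q Q N)"
      by (simp only: step)
    also have "\<dots> = (G (2 * N) * (qpoch x Q N * qpoch Q Q N)) * (1 - w * Q ^ N)"
      by (simp only: mult_ac)
    finally show ?case by (simp only: Suc qpoch_Suc)
  qed
  have "(\<lambda>N. G (2 * N) * (qpoch x Q N * qpoch Q Q N))
    \<longlonglongrightarrow> gen_fun z P2' (weight c) (\<lambda>xs. nat (alt_sum xs)) * (qpoch_inf x Q * qpoch_inf Q Q)"
    unfolding G_def P2' by (intro tendsto_mult_fps parity_gen_fun_tendsto qpoch_tendsto Q0) simp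
  then show ?thesis
    unfolding fin using qpoch_tendsto[OF Q0] LIMSEQ_unique by blast
qed

text \<open>The unpaired position 0 yields (1 - w) / (1 - x), and the pair (2i + 1, 2i + 2) yields
  (1 - w Q^(i+1)) / ((1 - x Q^(i+1))(1 - Q Q^i)). At each finite stage the products in
  \<open>w\<close> and \<open>x\<close> are therefore one factor longer than the product in
  \<open>Q\<close>.\<close>

lemma gen_fun_P1':
  assumes hw0: "fps_const z * fps_X ^ C 0 = - w"
    and hw: "\<And>i. fps_const z * fps_X ^ (C (2 * i + 1) + C (2 * i + 2)) = - w * Q ^ Suc i"
  shows "gen_fun z P1' (weight c) (\<lambda>xs. nat (alt_sum xs)) * (qpoch_inf x Q * qpoch_inf Q Q) = qpoch_inf w Q"
proof -
  define G where "G k = gen_fun z (diff_seqs False k) (lin C k) (lin (\<lambda>i. of_bool (even i)) k)" for k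
  have P1': "P1' = parity_partitions False"
    by (simp add: P1'_def parity_partitions_def)
  have fin: "G (2 * N + 1) * (qpoch x Q (Suc N) * qpoch Q Q N) = qpoch w Q (Suc N)" for N
  proof (induction N)
    case 0
    show ?case
      using gen_fun_diff_seqs_1[of C z "\<lambda>i. of_bool (even i)", OF C_pos] hx[of 0] hw0
      by (simp add: G_def qpoch_Suc)
next
    case (Suc N)
    have step: "G (2 * Suc N + 1) * ((1 - x * Q ^ Suc N) * (1 - Q * Q ^ N)) = G (2 * N + 1) * (1 - w * Q ^ Suc N)"
      using gen_fun_diff_seqs_step[OF _ C_pos C_pos finite_fibers_diff_seqs, of "2 * N + 1" False z "\<lambda>i. of_bool (even i)"]
      using hx[of "Suc N"] hQ[of N] hw[of N] by (simp add: G_def mult.commute[of "1 - Q * Q ^ N"])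
    have "G (2 * Suc N + 1) * (qpoch x Q (Suc (Suc N)) * qpoch Q Q (Suc N))
      = (G (2 * Suc N + 1) * ((1 - x * Q ^ Suc N) * (1 - Q * Q ^ N))) * (qpoch x Q (Suc N) * qpoch Q Q N)"
      by (simp only: qpoch_Suc[of x Q "Suc N"] qpoch_Suc[of Q Q N] mult_ac)
    also have "\<dots> = (G (2 * N + 1) * (1 - w * Q ^ Suc N)) * (qpoch x Q (Suc N) * qpoch Q Q N)"
      by (simp only: step)
    also have "\<dots> = (G (2 * N + 1) * (qpoch x Q (Suc N) * qpoch Q Q N)) * (1 - w * Q ^ Suc N)"
      by (simp only: mult_ac)
    finally show ?case by (simp only: Suc qpoch_Suc[of w Q "Suc N"])
  qed
  have "(\<lambda>N. G (2 * N + 1) * (qpoch x Q (Suc N) * qpoch Q Q N))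
    \<longlonglongrightarrow> gen_fun z P1' (weight c) (\<lambda>xs. nat (alt_sum xs)) * (qpoch_inf x Q * qpoch_inf Q Q)"
    unfolding G_def P1'
    by (intro tendsto_mult_fps parity_gen_fun_tendsto qpoch_tendsto LIMSEQ_Suc Q0) simp
  then show ?thesis
    unfolding fin using qpoch_tendsto[OF Q0, THEN LIMSEQ_Suc] LIMSEQ_unique by blast
qed

end

end


section \<open>Specialisation to the four identities\<close>

lemma sum_of_bool_even: "(\<Sum>j\<le>i. of_bool (even j)) = Suc (i div 2)"
  by (induction i) auto

text \<open>Together with \<open>fps_X_power_eq\<close>, this reduces the hypotheses
  \<open>hx\<close>, \<open>hQ\<close> and \<open>hw\<close> to equations between exponents.\<close>

lemma monomial_eq: "n = k + m * i \<Longrightarrow> a * fps_X ^ n = a * fps_X ^ k * (fps_X ^ m) ^ i"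
  by (simp add: power_add power_mult mult.assoc)

lemma fps_X_power_eq: "n = m + m * i \<Longrightarrow> fps_X ^ n = fps_X ^ m * (fps_X ^ m) ^ i"
  by (simp add: power_add power_mult)

lemma fls_X_inv_mult: "fls_X_inv * (fls_X * f) = (f :: 'a::comm_ring_1 fls)"
  by (simp add: fls_X_inv_times_conv_shift fls_X_times_conv_shift)

text \<open>The first three equations are the cancellations behind w' Q = w in the first three
  identities.\<close>

lemma fls_X_inv_cancel:
  "qv_inv ^ 3 * qv ^ 4 = qv" "qv_inv * qv ^ 4 = qv ^ 3" "qv_inv * qv ^ 2 = qv" "qv_inv * qv = 1"
  using fls_X_inv_mult[of "1 :: int poly fls"]
  by (simp_all add: eval_nat_numeral mult.assoc fls_X_inv_mult)

lemmas fls_monomial_simps = fls_X_inv_cancel power2_eq_square mult.assoc fls_times_fps_to_fls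
  fps_to_fls_power fls_const_power power_mult power_add

theorem theorem7p8:
  shows
    "(let F = (\<lambda>xs. zv ^ nat (alt_sum xs) * qv ^ (sum_list xs));
         A = (\<lambda>n. qv ^ (4 * n) * qpoch (- zv * qv_inv ^ 3) (qv ^ 4) n
           \<oslash> (qpoch (qv ^ 4) (qv ^ 4) n * qpoch (zv ^ 2 * qv ^ 2) (qv ^ 4) n));
         B = (\<lambda>n. zv ^ 2 * qv ^ (4 * n + 2) * qpoch (- zv * qv) (qv ^ 4) n
           \<oslash> (qpoch (qv ^ 4) (qv ^ 4) n * qpoch (zv ^ 2 * qv ^ 2) (qv ^ 4) (n + 1)))
     in F summable_on P1' \<and> summable A \<and> summable B \<and>
        (\<Sum>\<^sub>\<infinity>xs\<in>P1'. F xs) = (\<Sum>n. A n) + (\<Sum>n. B n) \<and>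
        (\<Sum>n. A n) + (\<Sum>n. B n) =
          qpoch_inf (- zv * qv) (qv ^ 4)
          \<oslash> (qpoch_inf (zv ^ 2 * qv ^ 2) (qv ^ 4) * qpoch_inf (qv ^ 4) (qv ^ 4))) \<and>
     (let F = (\<lambda>xs. zv ^ nat (alt_sum xs) * qv ^ (sum_list xs));
         A = (\<lambda>n. qv ^ (4 * n) * qpoch (- zv * qv_inv) (qv ^ 4) n
           \<oslash> (qpoch (qv ^ 4) (qv ^ 4) n * qpoch (zv ^ 2 * qv ^ 2) (qv ^ 4) n));
         B = (\<lambda>n. zv ^ 2 * qv ^ (4 * n + 2) * qpoch (- zv * qv ^ 3) (qv ^ 4) n
           \<oslash> (qpoch (qv ^ 4) (qv ^ 4) n * qpoch (zv ^ 2 * qv ^ 2) (qv ^ 4) (n + 1)))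
     in F summable_on P2' \<and> summable A \<and> summable B \<and>
        (\<Sum>\<^sub>\<infinity>xs\<in>P2'. F xs) = (\<Sum>n. A n) + (\<Sum>n. B n) \<and>
        (\<Sum>n. A n) + (\<Sum>n. B n) =
          qpoch_inf (- zv * qv ^ 3) (qv ^ 4)
          \<oslash> (qpoch_inf (zv ^ 2 * qv ^ 2) (qv ^ 4) * qpoch_inf (qv ^ 4) (qv ^ 4))) \<and>
     (let F = (\<lambda>xs. zv ^ nat (alt_sum xs) * qv ^ (schmidt_weight xs));
         A = (\<lambda>n. qv ^ (2 * n) * qpoch (- zv * qv_inv) (qv ^ 2) n
           \<oslash> (qpoch (qv ^ 2) (qv ^ 2) n * qpoch (zv ^ 2 * qv ^ 2) (qv ^ 2) n));
         B = (\<lambda>n. zv ^ 2 * qv ^ (2 * n + 2) * qpoch (- zv * qv) (qv ^ 2) n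
           \<oslash> (qpoch (qv ^ 2) (qv ^ 2) n * qpoch (zv ^ 2 * qv ^ 2) (qv ^ 2) (n + 1)))
     in F summable_on P1' \<and> summable A \<and> summable B \<and>
        (\<Sum>\<^sub>\<infinity>xs\<in>P1'. F xs) = (\<Sum>n. A n) + (\<Sum>n. B n) \<and>
        (\<Sum>n. A n) + (\<Sum>n. B n) =
          qpoch_inf (- zv * qv) (qv ^ 2)
          \<oslash> (qpoch_inf (zv ^ 2 * qv ^ 2) (qv ^ 2) * qpoch_inf (qv ^ 2) (qv ^ 2))) \<and>
     (let F = (\<lambda>xs. zv ^ nat (alt_sum xs) * qv ^ (schmidt_weight xs));
         A = (\<lambda>n. qv ^ (2 * n) * qpoch (- zv) (qv ^ 2) n
           \<oslash> (qpoch (qv ^ 2) (qv ^ 2) n * qpoch (zv ^ 2 * qv ^ 2) (qv ^ 2) n));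
         B = (\<lambda>n. zv ^ 2 * qv ^ (2 * n + 2) * qpoch (- zv * qv ^ 2) (qv ^ 2) n
           \<oslash> (qpoch (qv ^ 2) (qv ^ 2) n * qpoch (zv ^ 2 * qv ^ 2) (qv ^ 2) (n + 1)))
     in F summable_on P2' \<and> summable (\<lambda>n. A (Suc n)) \<and> summable B \<and>
        (\<Sum>\<^sub>\<infinity>xs\<in>P2'. F xs) = 1 + (\<Sum>n. A (Suc n)) + (\<Sum>n. B n) \<and>
        1 + (\<Sum>n. A (Suc n)) + (\<Sum>n. B n) =
          qpoch_inf (- zv * qv ^ 2) (qv ^ 2)
          \<oslash> (qpoch_inf (zv ^ 2 * qv ^ 2) (qv ^ 2) * qpoch_inf (qv ^ 2) (qv ^ 2)))"
  unfolding Let_def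
proof (rule conjI[OF _ conjI[OF _ conjI]], goal_cases)
  case 1
  \<comment> \<open>The exponent 1 in \<open>?w\<close> is kept explicit so that
    \<open>monomial_eq\<close> matches.\<close>
  let ?z = "[:0, 1:] :: int poly" and ?x = "fps_const ([:0, 1:] ^ 2) * fps_X ^ 2 :: int poly fps"
    and ?w = "- (fps_const [:0, 1:] * fps_X ^ 1)"
    and ?Q = "fps_X ^ 4 :: int poly fps"
  have C: "Suc i = (\<Sum>j\<le>i. 1)" "i < 2 * Suc i" for i
    by simp_all
  have G: "gen_fun ?z P1' (weight (\<lambda>_. 1)) (\<lambda>xs. nat (alt_sum xs)) * (qpoch_inf ?x ?Q * qpoch_inf ?Q ?Q)
      = qpoch_inf ?w ?Q"
    by (rule gen_fun_P1'[where C = Suc], rule C, rule C)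
      (simp_all only: minus_minus, (rule monomial_eq fps_X_power_eq | simp)+)
  have F: "((\<lambda>xs. zv ^ nat (alt_sum xs) * qv ^ sum_list xs) has_sum
      fps_to_fls (gen_fun ?z P1' (weight (\<lambda>_. 1)) (\<lambda>xs. nat (alt_sum xs)))) P1'"
    unfolding sum_list_conv_weight
    by (rule has_sum_gen_fun, rule finite_fibers_weight[OF C]) (auto simp: P1'_def)
  show ?case
    by (rule qpoch_identity(1)[OF _ _ _ G F, where w' = "- zv * qv_inv ^ 3"])
      (simp_all add: fls_monomial_simps)
next
  case 2
  let ?z = "[:0, 1:] :: int poly" and ?x = "fps_const ([:0, 1:] ^ 2) * fps_X ^ 2 :: int poly fps"
    and ?w = "- (fps_const [:0, 1:] * fps_X ^ 3)"
    and ?Q = "fps_X ^ 4 :: int poly fps"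
  have C: "Suc i = (\<Sum>j\<le>i. 1)" "i < 2 * Suc i" for i
    by simp_all
  have G: "gen_fun ?z P2' (weight (\<lambda>_. 1)) (\<lambda>xs. nat (alt_sum xs)) * (qpoch_inf ?x ?Q * qpoch_inf ?Q ?Q)
      = qpoch_inf ?w ?Q"
    by (rule gen_fun_P2'[where C = Suc], rule C, rule C)
      (simp_all only: minus_minus, (rule monomial_eq fps_X_power_eq | simp)+)
  have F: "((\<lambda>xs. zv ^ nat (alt_sum xs) * qv ^ sum_list xs) has_sum
      fps_to_fls (gen_fun ?z P2' (weight (\<lambda>_. 1)) (\<lambda>xs. nat (alt_sum xs)))) P2'"
    unfolding sum_list_conv_weight
    by (rule has_sum_gen_fun, rule finite_fibers_weight[OF C]) (auto simp: P2'_def)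
  show ?case
    by (rule qpoch_identity(1)[OF _ _ _ G F, where w' = "- zv * qv_inv"])
      (simp_all add: fls_monomial_simps)
next
  case 3
  let ?z = "[:0, 1:] :: int poly" and ?x = "fps_const ([:0, 1:] ^ 2) * fps_X ^ 2 :: int poly fps"
    and ?w = "- (fps_const [:0, 1:] * fps_X ^ 1)"
    and ?Q = "fps_X ^ 2 :: int poly fps"
  \<comment> \<open>The Schmidt weight counts even positions only, so positions 2i and 2i + 1 share
    the coefficient i + 1; this is why \<open>?Q\<close> is now q^2.\<close>
  have C: "Suc (i div 2) = (\<Sum>j\<le>i. of_bool (even j))" "i < 2 * Suc (i div 2)" for i
    by (simp_all add: sum_of_bool_even)
  have G: "gen_fun ?z P1' (weight (\<lambda>i. of_bool (even i))) (\<lambda>xs. nat (alt_sum xs)) * (qpoch_inf ?x ?Q * qpoch_inf ?Q ?Q)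
      = qpoch_inf ?w ?Q"
    by (rule gen_fun_P1'[where C = "\<lambda>i. Suc (i div 2)"], rule C, rule C)
      (simp_all only: minus_minus, (rule monomial_eq fps_X_power_eq | simp)+)
  have F: "((\<lambda>xs. zv ^ nat (alt_sum xs) * qv ^ schmidt_weight xs) has_sum
      fps_to_fls (gen_fun ?z P1' (weight (\<lambda>i. of_bool (even i))) (\<lambda>xs. nat (alt_sum xs)))) P1'"
    unfolding schmidt_weight_conv_weight
    by (rule has_sum_gen_fun, rule finite_fibers_weight[OF C]) (auto simp: P1'_def)
  show ?case
    by (rule qpoch_identity(1)[OF _ _ _ G F, where w' = "- zv * qv_inv"])
      (simp_all add: fls_monomial_simps)
next
  case 4
  let ?z = "[:0, 1:] :: int poly" and ?x = "fps_const ([:0, 1:] ^ 2) * fps_X ^ 2 :: int poly fps"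
    and ?w = "- (fps_const [:0, 1:] * fps_X ^ 2)"
    and ?Q = "fps_X ^ 2 :: int poly fps"
  have C: "Suc (i div 2) = (\<Sum>j\<le>i. of_bool (even j))" "i < 2 * Suc (i div 2)" for i
    by (simp_all add: sum_of_bool_even)
  have G: "gen_fun ?z P2' (weight (\<lambda>i. of_bool (even i))) (\<lambda>xs. nat (alt_sum xs)) * (qpoch_inf ?x ?Q * qpoch_inf ?Q ?Q)
      = qpoch_inf ?w ?Q"
    by (rule gen_fun_P2'[where C = "\<lambda>i. Suc (i div 2)"], rule C, rule C)
      (simp_all only: minus_minus, (rule monomial_eq fps_X_power_eq | simp)+)
  have F: "((\<lambda>xs. zv ^ nat (alt_sum xs) * qv ^ schmidt_weight xs) has_sum
      fps_to_fls (gen_fun ?z P2' (weight (\<lambda>i. of_bool (even i))) (\<lambda>xs. nat (alt_sum xs)))) P2'"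
    unfolding schmidt_weight_conv_weight
    by (rule has_sum_gen_fun, rule finite_fibers_weight[OF C]) (auto simp: P2'_def)
  \<comment> \<open>\<open>A\<close> is given explicitly because the goal shows only its values at
    \<open>Suc n\<close>.\<close>
  show ?case
    by (rule qpoch_identity(2)[OF _ _ _ G F, where w' = "- zv"
      and A = "\<lambda>n. qv ^ (2 * n) * qpoch (- zv) (qv ^ 2) n
           \<oslash> (qpoch (qv ^ 2) (qv ^ 2) n * qpoch (zv ^ 2 * qv ^ 2) (qv ^ 2) n)"])
      (simp_all add: fls_monomial_simps)
qed

end
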